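(* Let $k\ge 3$ be an odd integer, let $G=(V,E)$ be a graph and let $\mathbf w:E\to\mathbb Z_{+}$ be an edge weight function. Let $E_k$ be the edge set produced by the following algorithm: (1) Let $\hat{\mathbf x}^*$ be an optimal solution of the linear program $\min\{\mathbf w^T\mathbf x : A\mathbf x\ge \mathbf 1,\ 0\le \mathbf x\le 1\}$, where $A$ is the $k$-cycle--edge incidence matrix of $G$ (rows indexed by the $k$-cycles of $G$, columns by the edges, entry $1$ iff the edge lies on the cycle). (2) Let $E_{k_1}=\{e\in E : \hat{\mathbf x}^*_e\ge 2/(2k-1)\}$. (3) Let $E'$ be the set of edges lying on some $k$-cycle of $G-E_{k_1}$, and let $G'$ be the subgraph of $G$ formed by the edge set $E'$. (4) Choose any bipartite subgraph $B=(V_1,V_2,E_B)$ of $G'$ with $\mathbf w(E_B)\ge \tfrac12\mathbf w(E')$, and let $E_{k_2}=E'\setminus E_B$. (5) Output $E_k=E_{k_1}\cup E_{k_2}$. Then $E_k$ is a $k$-cycle covering of $G$ and $\mathbf w(E_k)\le (k-\tfrac12)\,\tau_k(G_w)$.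
   Context: A $k$-cycle covering of $G$ is an edge subset $A\subseteq E$ such that $G-A$ contains no cycle of length $k$. The weighted covering number $\tau_k(G_w)$ is the minimum of $\sum_{e\in A}\mathbf w_e$ over all $k$-cycle coverings $A$ of $G$, equivalently $\min\{\mathbf w^T\mathbf x: A\mathbf x\ge\mathbf 1,\ \mathbf x\in\{0,1\}^{E}\}$ with $A$ the $k$-cycle--edge incidence matrix. For $F\subseteq E$, $\mathbf w(F)=\sum_{e\in F}\mathbf w_e$. *)

theory Defs
  imports Complex_Main
begin

text \<open>
  A graph is a pair of a vertex set and a set of edges; graphs are finite and simple,
  so an edge is a two-element set of vertices.
\<close>

type_synonym 'a graph = "'a set \<times> 'a set set"

abbreviation verts :: "'a graph \<Rightarrow> 'a set" where
  "verts G \<equiv> fst G"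

abbreviation edges :: "'a graph \<Rightarrow> 'a set set" where
  "edges G \<equiv> snd G"

definition graph :: "'a graph \<Rightarrow> bool" where
  "graph G \<longleftrightarrow> finite (verts G) \<and> (\<forall>e\<in>edges G. e \<subseteq> verts G \<and> card e = 2)"

definition subgraph :: "'a graph \<Rightarrow> 'a graph \<Rightarrow> bool" where
  "subgraph H G \<longleftrightarrow> graph H \<and> verts H \<subseteq> verts G \<and> edges H \<subseteq> edges G"

definition delete_edges :: "'a graph \<Rightarrow> 'a set set \<Rightarrow> 'a graph" where
  "delete_edges G F = (verts G, edges G - F)"

definition formed_by :: "'a set set \<Rightarrow> 'a graph" where
  "formed_by F = (\<Union>F, F)"

definition bipartition :: "'a graph \<Rightarrow> 'a set \<Rightarrow> 'a set \<Rightarrow> bool" where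
  "bipartition B V1 V2 \<longleftrightarrow>
     verts B = V1 \<union> V2 \<and> V1 \<inter> V2 = {} \<and> (\<forall>e\<in>edges B. \<exists>u\<in>V1. \<exists>v\<in>V2. e = {u, v})"

definition closed_walk_edges :: "'a list \<Rightarrow> 'a set set" where
  "closed_walk_edges vs = {{vs ! i, vs ! ((i + 1) mod length vs)} | i. i < length vs}"

text \<open>
  A cycle is represented by its edge set, so that cyclic shifts and reversals of
  the same vertex sequence are one cycle.
\<close>

definition k_cycles :: "nat \<Rightarrow> 'a graph \<Rightarrow> 'a set set set" where
  "k_cycles k G = {closed_walk_edges vs | vs.
     3 \<le> k \<and> length vs = k \<and> distinct vs \<and> set vs \<subseteq> verts G \<and> closed_walk_edges vs \<subseteq> edges G}"

definition k_cycle_covering :: "nat \<Rightarrow> 'a graph \<Rightarrow> 'a set set \<Rightarrow> bool" where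
  "k_cycle_covering k G A \<longleftrightarrow> A \<subseteq> edges G \<and> k_cycles k (delete_edges G A) = {}"

definition weight :: "('a set \<Rightarrow> nat) \<Rightarrow> 'a set set \<Rightarrow> nat" where
  "weight w F = (\<Sum>e\<in>F. w e)"

definition covering_number :: "nat \<Rightarrow> 'a graph \<Rightarrow> ('a set \<Rightarrow> nat) \<Rightarrow> nat" where
  "covering_number k G w = Min {weight w A | A. k_cycle_covering k G A}"

definition incidence :: "'a set set \<Rightarrow> 'a set \<Rightarrow> real" where
  "incidence C e = (if e \<in> C then 1 else 0)"

definition lp_feasible :: "nat \<Rightarrow> 'a graph \<Rightarrow> ('a set \<Rightarrow> real) \<Rightarrow> bool" where
  "lp_feasible k G x \<longleftrightarrow>
     (\<forall>C\<in>k_cycles k G. (\<Sum>e\<in>edges G. incidence C e * x e) \<ge> 1) \<and>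
     (\<forall>e\<in>edges G. 0 \<le> x e \<and> x e \<le> 1)"

definition lp_value :: "'a graph \<Rightarrow> ('a set \<Rightarrow> nat) \<Rightarrow> ('a set \<Rightarrow> real) \<Rightarrow> real" where
  "lp_value G w x = (\<Sum>e\<in>edges G. real (w e) * x e)"

definition lp_optimal :: "nat \<Rightarrow> 'a graph \<Rightarrow> ('a set \<Rightarrow> nat) \<Rightarrow> ('a set \<Rightarrow> real) \<Rightarrow> bool" where
  "lp_optimal k G w x \<longleftrightarrow>
     lp_feasible k G x \<and> (\<forall>y. lp_feasible k G y \<longrightarrow> lp_value G w x \<le> lp_value G w y)"

end

theory Submission
  imports Defs
begin

text \<open>
  Put \<open>c = k - 1/2\<close>. Edges rounded up in the first step satisfy \<open>x e \<ge> 1/c\<close>. A surviving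
  \<open>k\<close>-cycle has total value at least 1 while each of its edges has value below \<open>1/c\<close>, so each of
  its edges still has value at least \<open>1 - (k - 1)/c = 1/(2 c)\<close>. Hence \<open>w(E')\<close> is at most \<open>2 c\<close>
  times the part of the LP value on \<open>E'\<close>, and discarding the bipartite half leaves at most \<open>c\<close>
  times that part. As the two edge sets are disjoint, the total is at most \<open>c\<close> times the LP
  optimum, which bounds the covering number from below. Since \<open>k\<close> is odd, no \<open>k\<close>-cycle survives
  inside the bipartite graph.
\<close>

lemma finite_edges:
  assumes "graph G"
  shows "finite (edges G)"
proof (rule finite_subset)
  show "edges G \<subseteq> Pow (verts G)" using assms by (auto simp: graph_def)
  show "finite (Pow (verts G))" using assms by (simp add: graph_def)
qed

lemma closed_walk_edges_eq_image:
  "closed_walk_edges vs = (\<lambda>i. {vs ! i, vs ! ((i + 1) mod length vs)}) ` {..<length vs}"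
  by (auto simp: closed_walk_edges_def)

lemma finite_k_cycle: "C \<in> k_cycles k G \<Longrightarrow> finite C"
  by (auto simp: k_cycles_def closed_walk_edges_eq_image)

lemma card_k_cycle_le: "C \<in> k_cycles k G \<Longrightarrow> card C \<le> k"
  using card_image_le[of "{..<k}"] by (auto simp: k_cycles_def closed_walk_edges_eq_image)

lemma k_cycle_nonempty: "C \<in> k_cycles k G \<Longrightarrow> C \<noteq> {}"
  by (auto simp: k_cycles_def closed_walk_edges_eq_image lessThan_empty_iff)

lemma k_cycle_subset_edges: "C \<in> k_cycles k G \<Longrightarrow> C \<subseteq> edges G"
  by (auto simp: k_cycles_def)

lemma k_cycles_delete_edges:
  "C \<in> k_cycles k (delete_edges G F) \<longleftrightarrow> C \<in> k_cycles k G \<and> C \<inter> F = {}"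
  by (auto simp: k_cycles_def delete_edges_def)

text \<open>Hitting-set form of covering, which matches the LP constraints at 0/1 points.\<close>

lemma k_cycle_covering_iff:
  "k_cycle_covering k G A \<longleftrightarrow> A \<subseteq> edges G \<and> (\<forall>C\<in>k_cycles k G. C \<inter> A \<noteq> {})"
  unfolding k_cycle_covering_def using k_cycles_delete_edges[of _ k G A] by auto

text \<open>Each edge of \<open>B\<close> switches sides, so a closed walk inside \<open>B\<close>
  has even length.\<close>

lemma bipartition_no_odd_cycle:
  assumes B: "bipartition B V1 V2" and k: "odd k" and C: "C \<in> k_cycles k G"
  shows "\<not> C \<subseteq> edges B"
proof
  assume sub: "C \<subseteq> edges B"
  obtain vs where vs: "C = closed_walk_edges vs" "length vs = k" "3 \<le> k"
    using C by (auto simp: k_cycles_def)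
  \<comment> \<open>The case \<open>i = k - 1\<close> is included: there the successor wraps around
    to vertex 0.\<close>
  have step: "vs ! ((i + 1) mod k) \<in> V1 \<longleftrightarrow> vs ! i \<notin> V1" if "i < k" for i
  proof -
    have "{vs ! i, vs ! ((i + 1) mod k)} \<in> edges B"
      using sub vs that by (auto simp: closed_walk_edges_def)
    then obtain u v where "u \<in> V1" "v \<in> V2" "{vs ! i, vs ! ((i + 1) mod k)} = {u, v}"
      using B by (auto simp: bipartition_def)
    moreover have "V1 \<inter> V2 = {}" using B by (simp add: bipartition_def)
    ultimately show ?thesis by (auto simp: doubleton_eq_iff)
  qed
  have alt: "vs ! i \<in> V1 \<longleftrightarrow> (even i \<longleftrightarrow> vs ! 0 \<in> V1)" if "i < k" for i
    using that
  proof (induction i)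
    case (Suc i)
    then show ?case using step[of i] by auto
  qed simp
  \<comment> \<open>As \<open>k - 1\<close> is even, the last vertex is on the side of the first,
    yet the closing edge separates them.\<close>
  show False using alt[of "k - 1"] step[of "k - 1"] k vs(3) by auto
qed

lemma lp_feasible_cycle_sum:
  assumes "graph G" "lp_feasible k G x" "C \<in> k_cycles k G"
  shows "1 \<le> (\<Sum>e\<in>C. x e)"
proof -
  have "(\<Sum>e\<in>edges G. incidence C e * x e) = (\<Sum>e\<in>edges G. if e \<in> C then x e else 0)"
    by (intro sum.cong) (auto simp: incidence_def)
  also have "\<dots> = (\<Sum>e\<in>edges G \<inter> C. x e)"
    using finite_edges[OF assms(1)] by (simp add: sum.inter_restrict)
  also have "edges G \<inter> C = C" using k_cycle_subset_edges[OF assms(3)] by auto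
  finally show ?thesis using assms(2,3) by (auto simp: lp_feasible_def)
qed

lemma covering_lp_feasible:
  assumes "graph G" "k_cycle_covering k G A"
  shows "lp_feasible k G (\<lambda>e. of_bool (e \<in> A))"
  unfolding lp_feasible_def
proof (intro conjI ballI)
  fix C assume C: "C \<in> k_cycles k G"
  then obtain e where e: "e \<in> C" "e \<in> A" using assms(2) by (auto simp: k_cycle_covering_iff)
  then have "e \<in> edges G" using k_cycle_subset_edges[OF C] by auto
  then have "incidence C e * of_bool (e \<in> A) \<le> (\<Sum>e\<in>edges G. incidence C e * of_bool (e \<in> A))"
    by (intro member_le_sum) (auto simp: incidence_def finite_edges[OF assms(1)])
  then show "1 \<le> (\<Sum>e\<in>edges G. incidence C e * of_bool (e \<in> A))"
    using e by (simp add: incidence_def)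
qed auto

lemma lp_value_of_edge_set:
  assumes "graph G" "A \<subseteq> edges G"
  shows "lp_value G w (\<lambda>e. of_bool (e \<in> A)) = real (weight w A)"
proof -
  have "(\<Sum>e\<in>edges G. real (w e) * of_bool (e \<in> A)) = (\<Sum>e\<in>A. real (w e) * of_bool (e \<in> A))"
    by (rule sum.mono_neutral_right) (use assms(2) finite_edges[OF assms(1)] in auto)
  then show ?thesis by (simp add: lp_value_def weight_def)
qed

lemma covering_number_attained:
  assumes "graph G"
  obtains A where "k_cycle_covering k G A" "covering_number k G w = weight w A"
proof -
  let ?S = "{weight w A | A. k_cycle_covering k G A}"
  have "?S \<subseteq> weight w ` Pow (edges G)" by (auto simp: k_cycle_covering_def)
  then have "finite ?S" by (rule finite_subset) (simp add: finite_edges[OF assms])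
  \<comment> \<open>This witness keeps \<open>Min\<close> from ranging over the empty set.\<close>
  moreover have "k_cycle_covering k G (edges G)"
    unfolding k_cycle_covering_iff using k_cycle_nonempty[of _ k G] k_cycle_subset_edges[of _ k G]
    by (simp add: Int_absorb2)
  then have "?S \<noteq> {}" by auto
  ultimately have "covering_number k G w \<in> ?S" unfolding covering_number_def by (rule Min_in)
  then show ?thesis using that by auto
qed

text \<open>The LP relaxes the covering problem: the indicator of a minimum covering is feasible and
  its value is the weight of that covering.\<close>

lemma lp_optimal_le_covering_number:
  assumes "graph G" "lp_optimal k G w x"
  shows "lp_value G w x \<le> real (covering_number k G w)"
proof -
  obtain A where A: "k_cycle_covering k G A" "covering_number k G w = weight w A"
    using covering_number_attained[OF assms(1)] .
  have "lp_value G w x \<le> lp_value G w (\<lambda>e. of_bool (e \<in> A))"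
    using assms covering_lp_feasible[OF assms(1) A(1)] by (auto simp: lp_optimal_def)
  then show ?thesis
    using A lp_value_of_edge_set[OF assms(1), of A w] by (simp add: k_cycle_covering_def)
qed

lemma light_cycle_edge_lower_bound:
  assumes "graph G" "lp_feasible k G x" "C \<in> k_cycles k G" "e \<in> C" "3 \<le> k"
    and light: "\<And>f. f \<in> C \<Longrightarrow> x f \<le> 2 / (2 * real k - 1)"
  shows "1 / (2 * real k - 1) \<le> x e"
proof -
  let ?d = "2 / (2 * real k - 1)"
  have fin: "finite C" using finite_k_cycle assms(3) .
  have d: "0 \<le> ?d" using assms(5) by simp
  have "1 \<le> x e + (\<Sum>f\<in>C - {e}. x f)"
    using lp_feasible_cycle_sum[OF assms(1-3)] sum.remove[OF fin assms(4), of x] by simp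
  also have "(\<Sum>f\<in>C - {e}. x f) \<le> real (card (C - {e})) * ?d"
    by (rule sum_bounded_above) (use light in auto)
  \<comment> \<open>Only \<open>card C \<le> k\<close> is at hand, which suffices because the
    threshold is nonnegative.\<close>
  also have "\<dots> \<le> (real k - 1) * ?d"
  proof (rule mult_right_mono[OF _ d])
    have "card (C - {e}) = card C - 1" using assms(4) by simp
    then show "real (card (C - {e})) \<le> real k - 1"
      using card_k_cycle_le[OF assms(3)] assms(5) by linarith
  qed
  also have "(real k - 1) * ?d = 1 - 1 / (2 * real k - 1)"
    using assms(5) by (simp add: field_simps)
  finally show ?thesis by simp
qed

text \<open>Charges each edge to its own LP term; applied with factor \<open>k - 1/2\<close> to
  \<open>Ek1\<close> and with twice that factor to \<open>E'\<close>.\<close>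

lemma weight_le_scaled_sum:
  assumes "\<And>e. e \<in> F \<Longrightarrow> 1 \<le> c * x e"
  shows "real (weight w F) \<le> c * (\<Sum>e\<in>F. real (w e) * x e)"
proof -
  have "real (weight w F) = (\<Sum>e\<in>F. real (w e) * 1)" by (simp add: weight_def)
  also have "\<dots> \<le> (\<Sum>e\<in>F. real (w e) * (c * x e))"
    by (intro sum_mono mult_left_mono) (use assms in auto)
  finally show ?thesis by (simp add: sum_distrib_left mult.left_commute)
qed

theorem theorem1:
  fixes k :: nat and G :: "'a graph" and w :: "'a set \<Rightarrow> nat"
    and x :: "'a set \<Rightarrow> real"
    and Ek1 E' Ek2 Ek :: "'a set set"
    and G' B :: "'a graph" and V1 V2 :: "'a set"
  assumes "3 \<le> k" and "odd k" and "graph G"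
    and "lp_optimal k G w x"
    and "Ek1 = {e \<in> edges G. x e \<ge> 2 / (2 * real k - 1)}"
    and "E' = {e \<in> edges G. \<exists>C\<in>k_cycles k (delete_edges G Ek1). e \<in> C}"
    and "G' = formed_by E'"
    and "subgraph B G'" and "bipartition B V1 V2"
    and "real (weight w (edges B)) \<ge> 1 / 2 * real (weight w E')"
    and "Ek2 = E' - edges B"
    and "Ek = Ek1 \<union> Ek2"
  shows "k_cycle_covering k G Ek \<and>
    real (weight w Ek) \<le> (real k - 1 / 2) * real (covering_number k G w)"
proof
  have Ek1: "Ek1 \<subseteq> edges G" and E': "E' \<subseteq> edges G" using assms(5,6) by auto
  have BE': "edges B \<subseteq> E'" using assms(7,8) by (simp add: subgraph_def formed_by_def)
  show "k_cycle_covering k G Ek"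
    unfolding k_cycle_covering_iff
  proof (intro conjI ballI notI)
    show "Ek \<subseteq> edges G" using Ek1 E' assms(11,12) by auto
    fix C assume C: "C \<in> k_cycles k G" and disj: "C \<inter> Ek = {}"
    then have "C \<in> k_cycles k (delete_edges G Ek1)"
      using assms(12) by (auto simp: k_cycles_delete_edges)
    \<comment> \<open>\<open>C\<close> itself survives the deletion of \<open>Ek1\<close>, so it
      witnesses membership in \<open>E'\<close> for all its edges.\<close>
    then have "C \<subseteq> E'" using assms(6) k_cycle_subset_edges[OF C] by auto
    then have "C \<subseteq> edges B" using disj assms(11,12) by auto
    then show False using bipartition_no_odd_cycle[OF assms(9,2) C] by simp
  qed
  have finG: "finite (edges G)" using finite_edges assms(3) .
  have fin: "finite Ek1" "finite E'" using finG Ek1 E' finite_subset by auto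
  have feas: "lp_feasible k G x" using assms(4) by (simp add: lp_optimal_def)
  let ?c = "real k - 1 / 2"
  let ?s = "\<lambda>F. \<Sum>e\<in>F. real (w e) * x e"
  have w1: "real (weight w Ek1) \<le> ?c * ?s Ek1"
    by (rule weight_le_scaled_sum) (use assms(1,5) in \<open>auto simp: field_simps\<close>)
  have "1 \<le> 2 * ?c * x e" if e: "e \<in> E'" for e
  proof -
    obtain C where C: "C \<in> k_cycles k G" "C \<inter> Ek1 = {}" "e \<in> C"
      using e k_cycles_delete_edges[of _ k G Ek1] unfolding assms(6) by blast
    have "x f \<le> 2 / (2 * real k - 1)" if "f \<in> C" for f
      using that C(2) k_cycle_subset_edges[OF C(1)] assms(5) by fastforce
    then have "1 / (2 * real k - 1) \<le> x e"
      using light_cycle_edge_lower_bound[OF assms(3) feas C(1,3) assms(1)] by blast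
    then show ?thesis using assms(1) by (simp add: field_simps)
  qed
  then have "real (weight w E') \<le> 2 * ?c * ?s E'" by (rule weight_le_scaled_sum)
  moreover have "weight w E' = weight w Ek2 + weight w (edges B)"
    unfolding weight_def assms(11) by (rule sum.subset_diff[OF BE' fin(2)])
  \<comment> \<open>\<open>B\<close> takes at least half of \<open>w(E')\<close>; this cancels the
    factor 2.\<close>
  ultimately have w2: "real (weight w Ek2) \<le> ?c * ?s E'"
    using assms(10) by (simp add: algebra_simps)
  \<comment> \<open>Every edge of \<open>E'\<close> lies on a cycle avoiding \<open>Ek1\<close>, so
    no LP term is charged by both parts.\<close>
  have disj: "Ek1 \<inter> E' = {}" using k_cycles_delete_edges[of _ k G Ek1] unfolding assms(6) by blast
  have "weight w Ek = weight w Ek1 + weight w Ek2"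
    unfolding weight_def assms(12)
    by (rule sum.union_disjoint) (use fin disj assms(11) in auto)
  then have "real (weight w Ek) \<le> ?c * (?s Ek1 + ?s E')"
    using w1 w2 by (simp add: distrib_left)
  also have "?s Ek1 + ?s E' = ?s (Ek1 \<union> E')"
    using fin disj by (simp add: sum.union_disjoint)
  \<comment> \<open>The edges outside both sets contribute nonnegative terms, since \<open>x\<close>
    is feasible.\<close>
  also have "?c * \<dots> \<le> ?c * lp_value G w x"
    unfolding lp_value_def
  proof (intro mult_left_mono sum_mono2 finG)
    show "Ek1 \<union> E' \<subseteq> edges G" using Ek1 E' by simp
  qed (use feas assms(1) in \<open>auto simp: lp_feasible_def\<close>)
  also have "\<dots> \<le> ?c * real (covering_number k G w)"
    using lp_optimal_le_covering_number[OF assms(3,4)] assms(1) by (intro mult_left_mono) auto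
  finally show "real (weight w Ek) \<le> ?c * real (covering_number k G w)" .
qed

end
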